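(* For every integer $n\geq 0$, $11\mid MO(4,11n+6)$.
   Context: For $t\geq 1$, the integers $MO(t,n)$ are defined by the formal power series $$U_t(q)=\sum_{n\geq0}MO(t,n)\,q^n=\sum_{1\leq k_1<k_2<\cdots<k_t}\frac{q^{k_1+k_2+\cdots+k_t}}{(1-q^{k_1})^2(1-q^{k_2})^2\cdots(1-q^{k_t})^2}.$$ *)

theory Defs
  imports "HOL-Analysis.Analysis" "HOL-Computational_Algebra.Formal_Power_Series"
begin

text \<open>
  Since \<open>int\<close> is not a field, fps division is not available over it; for \<open>k \<ge> 1\<close> the series
  \<open>(1 - X ^ k)\<^sup>2\<close> has constant coefficient \<open>1\<close> and is a unit, and its inverse is given by
  \<^term>\<open>fps_right_inverse\<close>, whose second argument is the constant coefficient of the inverse.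
  The lemma \<open>inv_sq_unique\<close> below pins it down.
\<close>

definition inv_sq :: "nat \<Rightarrow> int fps" where
  "inv_sq k = fps_right_inverse ((1 - fps_X ^ k)\<^sup>2) 1"

definition increasing_tuples :: "nat \<Rightarrow> nat list set" where
  "increasing_tuples t = {ks. length ks = t \<and> sorted_wrt (<) ks \<and> (\<forall>k\<in>set ks. 1 \<le> k)}"

definition U_term :: "nat list \<Rightarrow> int fps" where
  "U_term ks = fps_X ^ sum_list ks * (\<Prod>k\<leftarrow>ks. inv_sq k)"

text \<open>
  The infinite sum is taken in the \<open>X\<close>-adic topology of \<^typ>\<open>int fps\<close>; it converges
  by \<open>U_term_summable\<close> below.
\<close>

definition U :: "nat \<Rightarrow> int fps" where
  "U t = (\<Sum>\<^sub>\<infinity>ks\<in>increasing_tuples t. U_term ks)"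

definition MO :: "nat \<Rightarrow> nat \<Rightarrow> int" where
  "MO t n = fps_nth (U t) n"

lemma inv_sq_unique:
  assumes "1 \<le> k"
  shows "(1 - fps_X ^ k)\<^sup>2 * g = 1 \<longleftrightarrow> g = inv_sq k"
proof -
  have "fps_nth ((1 - fps_X ^ k)\<^sup>2 :: int fps) 0 = 1"
    using assms by (simp add: fps_power_zeroth power_0_left)
  then have *: "(1 - fps_X ^ k)\<^sup>2 * inv_sq k = 1"
    unfolding inv_sq_def by (intro fps_right_inverse) simp
  show ?thesis
  proof
    assume g: "(1 - fps_X ^ k)\<^sup>2 * g = 1"
    have "g = ((1 - fps_X ^ k)\<^sup>2 * inv_sq k) * g" using * by simp
    also have "\<dots> = ((1 - fps_X ^ k)\<^sup>2 * g) * inv_sq k" by (simp add: mult_ac)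
    finally show "g = inv_sq k" using g by simp
  qed (use * in simp)
qed

lemma U_term_nth_eq_0: "n < sum_list ks \<Longrightarrow> fps_nth (U_term ks) n = 0"
  by (simp add: U_term_def fps_X_power_mult_nth)

lemma finite_increasing_tuples_sum_le:
  "finite {ks \<in> increasing_tuples t. sum_list ks \<le> n}"
proof (rule finite_subset)
  show "{ks \<in> increasing_tuples t. sum_list ks \<le> n} \<subseteq> {ks. set ks \<subseteq> {..n} \<and> length ks = t}"
    using member_le_sum_list by (fastforce simp: increasing_tuples_def)
qed (simp add: finite_lists_length_eq)

lemma U_term_has_sum:
  "(U_term has_sum
      Abs_fps (\<lambda>n. \<Sum>ks | ks \<in> increasing_tuples t \<and> sum_list ks \<le> n. fps_nth (U_term ks) n))
    (increasing_tuples t)"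
  unfolding has_sum_def
proof (rule tendsto_fpsI)
  fix n
  let ?S = "{ks \<in> increasing_tuples t. sum_list ks \<le> n}"
  have "fps_nth (sum U_term A) n = (\<Sum>ks\<in>?S. fps_nth (U_term ks) n)"
    if "finite A" "?S \<subseteq> A" "A \<subseteq> increasing_tuples t" for A
    unfolding fps_sum_nth
    by (rule sum.mono_neutral_right) (use that in \<open>auto intro!: U_term_nth_eq_0\<close>)
  then show "\<forall>\<^sub>F A in finite_subsets_at_top (increasing_tuples t).
      fps_nth (sum U_term A) n =
      fps_nth (Abs_fps (\<lambda>n. \<Sum>ks | ks \<in> increasing_tuples t \<and> sum_list ks \<le> n.
        fps_nth (U_term ks) n)) n"
    unfolding eventually_finite_subsets_at_top
    using finite_increasing_tuples_sum_le[of t n] by (intro exI[of _ ?S]) auto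
qed

lemma U_term_summable: "U_term summable_on increasing_tuples t"
  using U_term_has_sum by (rule has_sum_imp_summable)

lemma MO_eq_finite_sum:
  "MO t n = (\<Sum>ks | ks \<in> increasing_tuples t \<and> sum_list ks \<le> n. fps_nth (U_term ks) n)"
  unfolding MO_def U_def infsumI[OF U_term_has_sum] by simp

end

theory Submission
  imports Defs
begin

text \<open>
  Write \<open>E = (1 - q) (1 - q^2) (1 - q^3) ...\<close>. The generating function of the \<open>U t\<close> in a variable
  \<open>x\<close> is the product of the factors \<open>1 + x q^k / (1 - q^k)^2\<close>. Since
  \<open>(1 - q^k)^2 + x q^k = (1 - w q^k) (1 - q^k / w)\<close> for \<open>w + 1/w = 2 - x\<close>, the Jacobi triple
  product expands it, and comparing powers of \<open>x\<close> gives
    \<open>U t * E^3 = \<Sum>n. (-1)^n p t n q^(n(n+1)/2)\<close>,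
  where \<open>p t n\<close> is, up to sign, \<open>(2n+1)/(2t+1) * (n+t choose 2t)\<close>. The lemma \<open>U_phi_nth\<close> states this;
  its proof expands the truncated products \<open>k \<le> N\<close> with \<open>q\<close>-binomial coefficients, by
  induction on \<open>N\<close>.

  For \<open>t = 4\<close> the coefficient \<open>p 4 n\<close> is divisible by 11 unless \<open>n\<close> is congruent to 4 or 6,
  and in both cases \<open>n(n+1)/2\<close> is congruent to 10. So modulo 11 the series \<open>U 4 * E^3\<close> lives on
  exponents congruent to 10. As \<open>U 4 * E^11 = (U 4 * E^3) * E^8\<close> and \<open>E^11\<close> is
  modulo 11 a series in \<open>q^11\<close>, the theorem follows once the coefficients of \<open>E^8\<close> at exponents
  congruent to 7 are known to be divisible by 11 (\<open>eleven_dvd_class_part_7_phi_power_8\<close>).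

  That divisibility reflects the complex multiplication of \<open>\<eta>(3\<tau>)^8\<close> by
  the field of cube roots of unity, in which 11 is inert. It is proved here without modular forms, from
  the sparsity of \<open>E\<close> and \<open>E^3\<close>. By the pentagonal number theorem \<open>E\<close> has
  exponents only in the classes 0, 1, 2, 4, 5, 7 modulo 11; let \<open>a, b, d, c, z, e\<close>
  be the corresponding parts of \<open>E\<close>. By Jacobi's formula for \<open>E^3\<close> (the case
  \<open>t = 0\<close>), the classes 2, 5, 7, 8, 9 of \<open>(a + b + c + d + e + z)^3\<close> vanish, which makes
  five cubic polynomials in these parts vanish, and class 4 is divisible by 11. The class 7
  part of the eighth power is a polynomial of degree 8 in the parts, and modulo 11 it lies in the ideal generated
  by those cubics; \<open>octic_certificate\<close> exhibits the cofactors.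
\<close>

section \<open>Divisibility in the ring of integral power series\<close>

text \<open>
  Equality of series up to the exponent \<open>n\<close> is expressed below as divisibility of their
  difference by \<open>X ^ Suc n\<close>, so that such approximations combine by the divisibility rules of a ring.
\<close>

lemma X_power_dvd_iff:
  fixes f :: "int fps"
  shows "fps_X ^ k dvd f \<longleftrightarrow> (\<forall>n<k. fps_nth f n = 0)"
proof
  assume "\<forall>n<k. fps_nth f n = 0"
  then have "f = fps_X ^ k * fps_shift k f"
    by (intro fps_ext) (simp add: fps_X_power_mult_nth)
  then show "fps_X ^ k dvd f"
    by (rule dvdI)
qed (auto elim!: dvdE simp: fps_X_power_mult_nth)

lemma numeral_dvd_fps_iff:
  fixes f :: "int fps"
  shows "numeral w dvd f \<longleftrightarrow> (\<forall>n. numeral w dvd fps_nth f n)"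
proof
  assume *: "\<forall>n. numeral w dvd fps_nth f n"
  have "f = numeral w * Abs_fps (\<lambda>n. fps_nth f n div numeral w)"
    by (intro fps_ext) (use * in \<open>simp add: numeral_fps_const\<close>)
  then show "numeral w dvd f"
    by (rule dvdI)
qed (auto elim!: dvdE simp: numeral_fps_const)

section \<open>The Euler product and the pentagonal number theorem\<close>

definition euler :: "nat \<Rightarrow> int fps" where
  "euler n = (\<Prod>k=1..n. 1 - fps_X ^ k)"

text \<open>
  The infinite product: its coefficient at \<open>n\<close> is that of any partial product with at
  least \<open>n\<close> factors.
\<close>

definition phi :: "int fps" where
  "phi = Abs_fps (\<lambda>n. fps_nth (euler n) n)"

lemma euler_0 [simp]: "euler 0 = 1"
  by (simp add: euler_def)

lemma euler_Suc: "euler (Suc n) = euler n * (1 - fps_X ^ Suc n)"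
  by (simp add: euler_def)

lemma euler_nth_0 [simp]: "fps_nth (euler n) 0 = 1"
  by (induction n) (simp_all add: euler_Suc del: power_Suc)

lemma phi_nth_0 [simp]: "fps_nth phi 0 = 1"
  by (simp add: phi_def)

lemma euler_nonzero [simp]: "euler n \<noteq> 0"
  by (metis euler_nth_0 fps_zero_nth zero_neq_one)

lemma euler_diff_dvd:
  assumes "n \<le> m"
  shows "fps_X ^ Suc n dvd euler m - euler n"
  using assms
proof (induction m rule: dec_induct)
  case (step m)
  have "fps_X ^ Suc n dvd (fps_X ^ Suc m * euler m :: int fps)"
    using step.hyps by (intro dvd_mult2 le_imp_power_dvd) simp
  from dvd_diff[OF step.IH this] show ?case
    by (simp add: euler_Suc algebra_simps)
qed simp

lemma phi_diff_dvd: "fps_X ^ Suc n dvd phi - euler n"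
  unfolding X_power_dvd_iff
proof (intro allI impI)
  fix i assume "i < Suc n"
  then have "fps_X ^ Suc i dvd euler n - euler i"
    by (intro euler_diff_dvd) simp
  then show "fps_nth (phi - euler n) i = 0"
    unfolding X_power_dvd_iff by (simp add: phi_def)
qed

definition triangle :: "nat \<Rightarrow> nat" where
  "triangle n = (\<Sum>i\<le>n. i)"

lemma triangle_simps [simp]: "triangle 0 = 0" "triangle (Suc n) = triangle n + Suc n"
  by (simp_all add: triangle_def)

lemma two_triangle: "2 * triangle n = n * (n + 1)"
  by (induction n) auto

lemma le_triangle: "n \<le> triangle n"
  by (cases n) auto

text \<open>
  Shanks' truncation of the pentagonal series. Its term \<open>k = 0\<close> is \<open>euler n\<close> and the
  others have order above \<open>n\<close>, so it approximates the Euler product; on the other hand its increments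
  in \<open>n\<close> telescope to the two next terms of the pentagonal series.
\<close>

definition shanks :: "nat \<Rightarrow> int fps" where
  "shanks n = (\<Sum>k\<le>n. (-1) ^ k * (\<Prod>j\<in>{k<..n}. 1 - fps_X ^ j) * fps_X ^ (k * n + triangle k))"

text \<open>
  The left-hand sum is what \<open>shanks n\<close> becomes when \<open>n\<close> grows by one, apart from the new
  term, and the right-hand sum is \<open>shanks n\<close> itself for \<open>m = n\<close>. The difference of the
  \<open>k\<close>-th terms is a difference of consecutive boundary terms because
  \<open>(1 - X ^ Suc k) * t (Suc k) = t k\<close>.
\<close>

lemma shanks_telescope:
  assumes "m \<le> n"
  defines "t \<equiv> \<lambda>k. (\<Prod>j\<in>{k<..n}. 1 - fps_X ^ j :: int fps)"
  shows "(\<Sum>k\<le>m. (-1) ^ k * ((1 - fps_X ^ Suc n) * t k) * fps_X ^ (k * Suc n + triangle k))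
       = (\<Sum>k\<le>m. (-1) ^ k * t k * fps_X ^ (k * n + triangle k))
         - (-1) ^ m * t m * fps_X ^ (Suc m * Suc n + triangle m)"
  using assms(1)
proof (induction m)
  case 0
  show ?case by (simp add: algebra_simps)
next
  case (Suc m)
  define A :: "int fps" where "A = fps_X ^ (Suc m * Suc n + triangle m)"
  have t: "t m = (1 - fps_X ^ Suc m) * t (Suc m)"
  proof -
    have "{m<..n} = insert (Suc m) {Suc m<..n}"
      using Suc.prems by auto
    then show ?thesis by (simp add: t_def)
  qed
  have e: "fps_X ^ (Suc m * n + triangle (Suc m)) = A"
    "fps_X ^ (Suc m * Suc n + triangle (Suc m)) = A * fps_X ^ Suc m"
    "fps_X ^ (Suc (Suc m) * Suc n + triangle (Suc m)) = A * fps_X ^ Suc m * fps_X ^ Suc n"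
    by (simp_all add: A_def algebra_simps flip: power_add power_Suc)
  show ?case
    unfolding sum.atMost_Suc Suc.IH[OF Suc_leD[OF Suc.prems]] e t A_def[symmetric]
    by (simp add: algebra_simps)
qed

lemma shanks_Suc:
  "shanks (Suc n) = shanks n
     - (-1) ^ n * (fps_X ^ (Suc n * Suc n + triangle n) + fps_X ^ (Suc n * Suc n + triangle (Suc n)))"
proof -
  have "{k<..Suc n} = insert (Suc n) {k<..n}" if "k \<le> n" for k
    using that by auto
  then have "shanks (Suc n) = (\<Sum>k\<le>n. (-1) ^ k * ((1 - fps_X ^ Suc n) *
      (\<Prod>j\<in>{k<..n}. 1 - fps_X ^ j)) * fps_X ^ (k * Suc n + triangle k))
    - (-1) ^ n * fps_X ^ (Suc n * Suc n + triangle (Suc n))"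
    unfolding shanks_def sum.atMost_Suc by (simp del: power_Suc mult_Suc mult_Suc_right triangle_simps) simp
  also have "\<dots> = shanks n
     - (-1) ^ n * (fps_X ^ (Suc n * Suc n + triangle n) + fps_X ^ (Suc n * Suc n + triangle (Suc n)))"
    unfolding shanks_telescope[OF order_refl] shanks_def by (simp add: algebra_simps)
  finally show ?thesis .
qed

lemma shanks_diff_euler_dvd: "fps_X ^ Suc n dvd shanks n - euler n"
proof -
  have "shanks n - euler n =
      (\<Sum>k\<in>{0<..n}. (-1) ^ k * (\<Prod>j\<in>{k<..n}. 1 - fps_X ^ j) * fps_X ^ (k * n + triangle k))"
  proof -
    have "{..n} = insert 0 {0<..n}" "{0<..n} = {1..n}" by auto
    then show ?thesis by (simp add: shanks_def euler_def)
  qed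
  also have "fps_X ^ Suc n dvd \<dots>"
  proof (intro dvd_sum dvd_mult le_imp_power_dvd)
    fix k assume "k \<in> {0<..n}"
    then show "Suc n \<le> k * n + triangle k"
      using le_triangle[of k] by (cases k) auto
  qed
  finally show ?thesis .
qed

text \<open>
  Multiplying by 6, the inverse of 2 modulo 11, turns both equations into formulas for \<open>e\<close>
  modulo 11 in terms of \<open>n\<close> modulo 11.
\<close>

lemma residue_of_pentagonal:
  assumes "2 * e = n * (3 * n + 1) \<or> 2 * e + n = n * (3 * n)"
  shows "e mod 11 \<in> {0, 1, 2, 4, 5, 7 :: nat}"
proof -
  define r where "r = n mod 11"
  have "r < 11" by (simp add: r_def)
  then have r: "r = 0 \<or> r = 1 \<or> r = 2 \<or> r = 3 \<or> r = 4 \<or> r = 5 \<or> r = 6 \<or> r = 7 \<or> r = 8 \<or> r = 9 \<or> r = 10" by arith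
  have "e mod 11 = (6 * r * (3 * r + 1)) mod 11 \<or> e mod 11 = (6 * r * (3 * r + 10)) mod 11"
    using assms
  proof
    assume "2 * e = n * (3 * n + 1)"
    then have "e + 11 * e = 6 * n * (3 * n + 1)" by simp
    then have "e mod 11 = (6 * n * (3 * n + 1)) mod 11" by (metis mod_mult_self2)
    also have "\<dots> = (6 * r * (3 * r + 1)) mod 11"
      unfolding r_def by (intro mod_mult_cong mod_add_cong refl) simp_all
    finally show ?thesis by simp
  next
    assume "2 * e + n = n * (3 * n)"
    then have "e + 11 * (e + 6 * n) = 6 * n * (3 * n + 10)" by (simp add: algebra_simps)
    then have "e mod 11 = (6 * n * (3 * n + 10)) mod 11" by (metis mod_mult_self2)
    also have "\<dots> = (6 * r * (3 * r + 10)) mod 11"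
      unfolding r_def by (intro mod_mult_cong mod_add_cong refl) simp_all
    finally show ?thesis by simp
  qed
  then show ?thesis using r by (elim disjE) simp_all
qed

lemma shanks_nth_eq_0:
  assumes "m mod 11 \<notin> {0, 1, 2, 4, 5, 7 :: nat}"
  shows "fps_nth (shanks n) m = 0"
proof (induction n)
  case 0
  show ?case using assms by (auto simp: shanks_def)
next
  case (Suc n)
  have 2: "2 * (Suc n * Suc n + triangle (Suc n)) = Suc n * (3 * Suc n + 1)"
    using two_triangle[of "Suc n"] by (simp add: algebra_simps)
  have 1: "2 * (Suc n * Suc n + triangle n) + Suc n = Suc n * (3 * Suc n)"
    using two_triangle[of n] by (simp add: algebra_simps)
  have "m \<noteq> Suc n * Suc n + triangle n" "m \<noteq> Suc n * Suc n + triangle (Suc n)"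
    using residue_of_pentagonal[OF disjI1[OF 2]] residue_of_pentagonal[OF disjI2[OF 1]] assms by metis+
  then have "fps_nth ((-1) ^ n * (fps_X ^ (Suc n * Suc n + triangle n)
     + fps_X ^ (Suc n * Suc n + triangle (Suc n)))) m = (0::int)"
    by (cases "even n") (simp_all del: mult_Suc mult_Suc_right triangle_simps)
  with Suc show ?case unfolding shanks_Suc by simp
qed

text \<open>
  Of the pentagonal number theorem only the classes of the exponents modulo 11 matter for the congruence.
\<close>

lemma phi_nth_eq_0:
  assumes "m mod 11 \<notin> {0, 1, 2, 4, 5, 7 :: nat}"
  shows "fps_nth phi m = 0"
  using phi_diff_dvd[of m] shanks_diff_euler_dvd[of m] shanks_nth_eq_0[OF assms, of m]
  unfolding X_power_dvd_iff by auto

section \<open>q-binomial coefficients\<close>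

fun qbin :: "nat \<Rightarrow> nat \<Rightarrow> int fps" where
  "qbin n 0 = 1"
| "qbin 0 (Suc k) = 0"
| "qbin (Suc n) (Suc k) = qbin n k + fps_X ^ Suc k * qbin n (Suc k)"

lemma qbin_eq_0: "n < k \<Longrightarrow> qbin n k = 0"
  by (induction n k rule: qbin.induct) auto

lemma qbin_self [simp]: "qbin n n = 1"
  by (induction n) (simp_all add: qbin_eq_0)

text \<open>
  The product formula, free of divisions. It yields the symmetry and the second Pascal rule by
  cancellation.
\<close>

lemma qbin_euler: "qbin (k + m) k * euler k * euler m = euler (k + m)"
proof (induction "k + m" arbitrary: k m)
  case (Suc n)
  show ?case
  proof (cases "k = 0 \<or> m = 0")
    case False
    then obtain k' m' where km: "k = Suc k'" "m = Suc m'"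
      by (auto simp: gr0_conv_Suc)
    have 1: "qbin n k' * euler k' * euler m = euler n"
      using Suc(1)[of k' m] Suc(2) km by simp
    have 2: "qbin n k * euler k * euler m' = euler n"
      using Suc(1)[of k m'] Suc(2) km by simp
    have n: "k + m = Suc n" using Suc(2) by simp
    have "qbin (k + m) k * euler k * euler m
        = (qbin n k' * euler k' * euler m) * (1 - fps_X ^ k)
          + fps_X ^ k * (qbin n k * euler k * euler m') * (1 - fps_X ^ m)"
      unfolding n by (simp only: km qbin.simps euler_Suc algebra_simps)
    also have "\<dots> = euler n * (1 - fps_X ^ (k + m))"
      unfolding 1 2 by (simp add: algebra_simps power_add)
    finally show ?thesis
      by (simp only: n euler_Suc)
  qed auto
qed simp

lemma qbin_symmetric: "qbin (k + m) k = qbin (k + m) m"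
proof -
  have "qbin (k + m) k * (euler k * euler m) = qbin (k + m) m * (euler k * euler m)"
    using qbin_euler[of k m] qbin_euler[of m k] by (simp add: ac_simps)
  then show ?thesis by simp
qed

lemma qbin_Suc_Suc':
  assumes "k \<le> n"
  shows "qbin (Suc n) (Suc k) = fps_X ^ (n - k) * qbin n k + qbin n (Suc k)"
proof (cases "k = n")
  case False
  define m where "m = n - Suc k"
  have n: "n = k + Suc m"
    using False assms by (simp add: m_def)
  have 1: "qbin (Suc n) (Suc k) * euler (Suc k) * euler (Suc m) = euler n * (1 - fps_X ^ Suc n)"
    using qbin_euler[of "Suc k" "Suc m"] by (simp add: n euler_Suc)
  have 2: "qbin n k * euler k * euler (Suc m) = euler n"
    using qbin_euler[of k "Suc m"] by (simp add: n)
  have 3: "qbin n (Suc k) * euler (Suc k) * euler m = euler n"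
    using qbin_euler[of "Suc k" m] by (simp add: n)
  have "(fps_X ^ Suc m * qbin n k + qbin n (Suc k)) * (euler (Suc k) * euler (Suc m))
      = fps_X ^ Suc m * (1 - fps_X ^ Suc k) * (qbin n k * euler k * euler (Suc m))
        + (1 - fps_X ^ Suc m) * (qbin n (Suc k) * euler (Suc k) * euler m)"
    unfolding euler_Suc by (simp only: algebra_simps)
  also have "\<dots> = euler n * (1 - fps_X ^ Suc n)"
    unfolding 2 3 by (simp add: n algebra_simps flip: power_add power_Suc)
  also have "\<dots> = qbin (Suc n) (Suc k) * (euler (Suc k) * euler (Suc m))"
    using 1 by (simp only: mult.assoc)
  finally show ?thesis
    by (simp add: n del: qbin.simps power_Suc)
qed (simp add: qbin_eq_0)

text \<open>
  Both Pascal rules combined: passing from \<open>n = 2 N + 1\<close> to \<open>2 N + 3\<close> corresponds to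
  one more factor of the truncated triple product.
\<close>

lemma qbin_Suc_Suc_Suc_Suc:
  assumes "Suc k \<le> n"
  shows "qbin (Suc (Suc n)) (Suc (Suc k)) =
    (1 + fps_X ^ Suc n) * qbin n (Suc k) + fps_X ^ (k + 2) * qbin n (k + 2) + fps_X ^ (n - k) * qbin n k"
proof -
  have e: "fps_X ^ Suc n = (fps_X ^ (k + 2) * fps_X ^ (n - Suc k) :: int fps)"
    using assms by (simp flip: power_add power_Suc)
  have "qbin (Suc (Suc n)) (Suc (Suc k)) = qbin (Suc n) (Suc k) + fps_X ^ (k + 2) * qbin (Suc n) (Suc (Suc k))"
    by (simp del: power_Suc)
  then show ?thesis
    unfolding qbin_Suc_Suc'[OF assms] qbin_Suc_Suc'[OF Suc_leD[OF assms]] e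
    by (simp add: algebra_simps del: power_Suc qbin.simps)
qed

section \<open>The truncated triple product\<close>

text \<open>
  In the finite form of the triple product, the product over \<open>1 \<le> k \<le> N\<close> of
  \<open>(1 - w X^k) (1 - X^k / w)\<close> equals the sum over \<open>n \<le> N\<close> of
  \<open>jacobi_coeff N n * (w^(-n) + ... + w^n)\<close>.
\<close>

definition jacobi_coeff :: "nat \<Rightarrow> nat \<Rightarrow> int fps" where
  "jacobi_coeff N n = (if n \<le> N then (-1) ^ n * fps_X ^ triangle n * qbin (2 * N + 1) (N - n) else 0)"

text \<open>
  The two recurrences say that the new factor \<open>1 + X^(2N+2) - X^(N+1) (w + 1/w)\<close> acts on the
  coefficients by shifts; at \<open>n = 0\<close> the left neighbour is replaced by
  \<open>- jacobi_coeff N 0\<close>, because \<open>w^(-n) + ... + w^n\<close> changes sign under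
  \<open>n \<mapsto> - 1 - n\<close>.
\<close>

lemma jacobi_coeff_Suc_0: "jacobi_coeff (Suc N) 0 =
   (1 + fps_X ^ (2 * Suc N)) * jacobi_coeff N 0 - fps_X ^ Suc N * (jacobi_coeff N 1 - jacobi_coeff N 0)"
proof (cases N)
  case 0
  have "qbin (Suc 0) (Suc 0) = 1" by simp
  then show ?thesis by (simp add: 0 jacobi_coeff_def numeral_2_eq_2 numeral_3_eq_3 algebra_simps)
next
  case (Suc m)
  have sym: "qbin (2 * N + 1) (Suc N) = qbin (2 * N + 1) N"
    using qbin_symmetric[of "Suc N" N] by (simp add: mult_2 del: qbin.simps)
  have "qbin (2 * Suc N + 1) (Suc N) = (1 + fps_X ^ (2 * Suc N)) * qbin (2 * N + 1) N
     + fps_X ^ Suc N * qbin (2 * N + 1) (Suc N) + fps_X ^ (N + 2) * qbin (2 * N + 1) (N - 1)"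
    using qbin_Suc_Suc_Suc_Suc[of m "2 * N + 1"] by (simp add: Suc del: qbin.simps power_Suc)
  then show ?thesis
    unfolding sym using Suc by (simp add: jacobi_coeff_def algebra_simps del: qbin.simps)
qed

lemma jacobi_coeff_Suc_Suc: "jacobi_coeff (Suc N) (Suc n) =
   (1 + fps_X ^ (2 * Suc N)) * jacobi_coeff N (Suc n) - fps_X ^ Suc N * (jacobi_coeff N n + jacobi_coeff N (n + 2))"
proof -
  consider "n > N" | "n = N" | "Suc n = N" | k where "N = n + k + 2"
  proof -
    have "n > N \<or> n = N \<or> Suc n = N \<or> N = n + (N - n - 2) + 2" by linarith
    then show ?thesis using that by blast
  qed
  then show ?thesis
  proof cases
    case 3
    have "qbin (2 * Suc N + 1) 1 = 1 + fps_X * qbin (2 * N + 2) 1" "qbin (2 * N + 2) 1 =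
      fps_X ^ (2 * N + 1) + qbin (2 * N + 1) 1"
      using qbin_Suc_Suc'[of 0 "2 * N + 1"] by (simp_all del: power_Suc)
    then have "qbin (2 * Suc N + 1) 1 = (1 + fps_X ^ (2 * Suc N)) + fps_X * qbin (2 * N + 1) 1"
      by (simp add: algebra_simps)
    then show ?thesis using 3[symmetric]
      by (simp add: jacobi_coeff_def algebra_simps power_add del: qbin.simps(3))
  next
    case (4 k)
    define Q where "Q = qbin (2 * N + 1)"
    have "qbin (2 * Suc N + 1) (k + 2) = (1 + fps_X ^ (2 * Suc N)) * Q (k + 1)
       + fps_X ^ (k + 2) * Q (k + 2) + fps_X ^ (2 * N + 1 - k) * Q k"
      using qbin_Suc_Suc_Suc_Suc[of k "2 * N + 1"] 4 by (simp add: Q_def del: qbin.simps power_Suc)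
    moreover have "fps_X ^ Suc N * fps_X ^ triangle n = (fps_X ^ (k + 2) * fps_X ^ triangle (Suc n) :: int fps)"
      "fps_X ^ Suc N * fps_X ^ triangle (n + 2) = (fps_X ^ (2 * N + 1 - k) * fps_X ^ triangle (Suc n) :: int fps)"
      using 4 by (simp_all add: algebra_simps flip: power_add power_Suc)
    moreover have "jacobi_coeff (Suc N) (Suc n) = - ((-1) ^ n) * fps_X ^ triangle (Suc n) * qbin (2 * Suc N + 1) (k + 2)"
      "jacobi_coeff N (Suc n) = - ((-1) ^ n) * fps_X ^ triangle (Suc n) * Q (k + 1)"
      "jacobi_coeff N n = (-1) ^ n * fps_X ^ triangle n * Q (k + 2)"
      "jacobi_coeff N (n + 2) = (-1) ^ n * fps_X ^ triangle (n + 2) * Q k"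
      using 4 by (simp_all add: jacobi_coeff_def Q_def del: qbin.simps triangle_simps)
    moreover have "- s * B * ((1 + Y) * q1 + P * q2 + W * q0) = (1 + Y) * (- s * B * q1) - R * (s * A * q2 + s * C * q0)"
      if "R * A = P * B" "R * C = W * B" for s A B C P W R Y q0 q1 q2 :: "int fps"
      using that by algebra
    ultimately show ?thesis by (simp only:)
  qed (auto simp: jacobi_coeff_def power_add algebra_simps)
qed

text \<open>
  The shifts are moved from the coefficients to the functions \<open>p\<close> that they multiply, again with
  the reflection \<open>p (- 1) = - p 0\<close> at the boundary.
\<close>

lemma jacobi_coeff_sum_Suc:
  fixes p :: "nat \<Rightarrow> int fps"
  defines "s \<equiv> \<lambda>n. p (Suc n) + (case n of 0 \<Rightarrow> - p 0 | Suc m \<Rightarrow> p m)"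
  shows "(\<Sum>n\<le>Suc N. jacobi_coeff (Suc N) n * p n) =
     (1 + fps_X ^ (2 * Suc N)) * (\<Sum>n\<le>N. jacobi_coeff N n * p n) - fps_X ^ Suc N * (\<Sum>n\<le>N. jacobi_coeff N n * s n)"
proof -
  have z: "jacobi_coeff N (Suc N) = 0" "jacobi_coeff N (Suc (Suc N)) = 0" by (simp_all add: jacobi_coeff_def)
  have 1: "(\<Sum>n\<le>N. jacobi_coeff N n * p n) = jacobi_coeff N 0 * p 0 + (\<Sum>n\<le>N. jacobi_coeff N (Suc n) * p (Suc n))"
    using sum.atMost_Suc_shift[of "\<lambda>n. jacobi_coeff N n * p n" N] by (simp add: z)
  have 2: "(\<Sum>n\<le>N. jacobi_coeff N n * (case n of 0 \<Rightarrow> - p 0 | Suc m \<Rightarrow> p m))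
     = - jacobi_coeff N 0 * p 0 + jacobi_coeff N 1 * p 0 + (\<Sum>n\<le>N. jacobi_coeff N (n + 2) * p (Suc n))"
    using sum.atMost_Suc_shift[of "\<lambda>n. jacobi_coeff N n * (case n of 0 \<Rightarrow> - p 0 | Suc m \<Rightarrow> p m)" N]
      sum.atMost_Suc_shift[of "\<lambda>n. jacobi_coeff N (Suc n) * p n" N] by (simp add: z)
  have s: "(\<Sum>n\<le>N. jacobi_coeff N n * s n) = (\<Sum>n\<le>N. jacobi_coeff N n * p (Suc n)) +
      (\<Sum>n\<le>N. jacobi_coeff N n * (case n of 0 \<Rightarrow> - p 0 | Suc m \<Rightarrow> p m))"
    by (simp add: s_def distrib_left sum.distrib)
  show ?thesis
    unfolding s 2 1 sum.atMost_Suc_shift jacobi_coeff_Suc_0 jacobi_coeff_Suc_Suc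
    by (simp add: algebra_simps sum.distrib sum_subtractf sum_distrib_left)
qed

text \<open>
  The coefficient of \<open>x ^ t\<close> in \<open>w^(-n) + ... + w^n\<close>, where \<open>w + 1/w = 2 - x\<close>.
  In this form with two binomial coefficients its second difference in \<open>n\<close> comes directly from Pascal's rule.
\<close>

definition jacobi_weight :: "nat \<Rightarrow> nat \<Rightarrow> int" where
  "jacobi_weight t n = (-1) ^ t * (int ((n + t) choose (2 * t)) + 2 * int ((n + t) choose (2 * t + 1)))"

lemma jacobi_weight_0: "jacobi_weight 0 n = 2 * int n + 1"
  by (simp add: jacobi_weight_def)

text \<open>
  Multiplication of \<open>w^(-n) + ... + w^n\<close> by \<open>w + 1/w = 2 - x\<close>, read off at
  \<open>x ^ Suc t\<close>.
\<close>

lemma jacobi_weight_second_difference: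
  "jacobi_weight (Suc t) (Suc n) + (case n of 0 \<Rightarrow> - jacobi_weight (Suc t) 0 | Suc m \<Rightarrow> jacobi_weight (Suc t) m) = 2 * jacobi_weight (Suc t) n - jacobi_weight t n"
proof (cases n)
  case 0
  show ?thesis
    by (cases "t = 0") (simp_all add: 0 jacobi_weight_def numeral_eq_Suc binomial_eq_0)
next
  case (Suc m)
  define x y s where "x = m + t + 1" and "y = 2 * t" and "s = (-1 :: int) ^ t"
  have pascal: "int (Suc (Suc x) choose Suc (Suc y)) + int (x choose Suc (Suc y))
      = 2 * int (Suc x choose Suc (Suc y)) + int (x choose y)" for x y
    by simp
  have "jacobi_weight (Suc t) (Suc n) = - s * (int (Suc (Suc x) choose Suc (Suc y))
          + 2 * int (Suc (Suc x) choose Suc (Suc (Suc y))))"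
    "jacobi_weight (Suc t) m = - s * (int (x choose Suc (Suc y)) + 2 * int (x choose Suc (Suc (Suc y))))"
    "jacobi_weight (Suc t) n = - s * (int (Suc x choose Suc (Suc y)) + 2 * int (Suc x choose Suc (Suc (Suc y))))"
    "jacobi_weight t n = s * (int (x choose y) + 2 * int (x choose Suc y))"
    by (simp_all add: Suc jacobi_weight_def x_def y_def s_def del: binomial_Suc_Suc)
  moreover note pascal[of x y] pascal[of x "Suc y"]
  moreover have "(case n of 0 \<Rightarrow> - jacobi_weight (Suc t) 0 | Suc m \<Rightarrow> jacobi_weight (Suc t) m) = jacobi_weight (Suc t) m"
    by (simp add: Suc)
  ultimately show ?thesis by algebra
qed

section \<open>The series U t as a theta quotient\<close>

text \<open>
  The contribution to \<open>U t\<close> of the tuples with entries at most \<open>N\<close>, split according to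
  whether the last entry is \<open>N\<close>: the elementary symmetric polynomials in the
  \<open>X ^ k * inv_sq k\<close>.
\<close>

fun U_upto :: "nat \<Rightarrow> nat \<Rightarrow> int fps" where
  "U_upto 0 N = 1"
| "U_upto (Suc t) 0 = 0"
| "U_upto (Suc t) (Suc N) = U_upto (Suc t) N + fps_X ^ Suc N * inv_sq (Suc N) * U_upto t N"

lemma U_upto_euler: "U_upto t N * euler N ^ 2 = (\<Sum>n\<le>N. jacobi_coeff N n * of_int (jacobi_weight t n))"
proof (induction N arbitrary: t)
  case 0
  show ?case by (cases t) (simp_all add: jacobi_coeff_def jacobi_weight_def binomial_eq_0)
next
  case (Suc N)
  define Q :: "int fps" where "Q = fps_X ^ Suc N"
  have QQ: "fps_X ^ (2 * Suc N) = Q ^ 2"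
    unfolding Q_def by (metis power_mult mult.commute)
  have eu: "euler (Suc N) = euler N * (1 - Q)"
    by (simp add: Q_def euler_Suc)
  define s :: "nat \<Rightarrow> nat \<Rightarrow> int fps" where "s t n = of_int (jacobi_weight t (Suc n)) + (case n of 0 \<Rightarrow> - of_int (jacobi_weight t 0) | Suc m \<Rightarrow> of_int (jacobi_weight t m))"
    for t n :: nat
  have step: "(\<Sum>n\<le>Suc N. jacobi_coeff (Suc N) n * of_int (jacobi_weight t n)) =
     (1 + Q ^ 2) * (U_upto t N * euler N ^ 2) - Q * (\<Sum>n\<le>N. jacobi_coeff N n * s t n)" for t
    unfolding jacobi_coeff_sum_Suc QQ Suc.IH s_def by (simp add: Q_def)
  show ?case
  proof (cases t)
    case 0
    have "s 0 n = 2 * of_int (jacobi_weight 0 n)" for n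
      by (simp add: s_def jacobi_weight_0 split: nat.split)
    then have "(\<Sum>n\<le>N. jacobi_coeff N n * s 0 n) = 2 * (U_upto 0 N * euler N ^ 2)"
      unfolding Suc.IH by (simp add: sum_distrib_left mult_ac)
    then show ?thesis
      unfolding step 0 eu by (simp add: power2_eq_square algebra_simps)
  next
    case (Suc r)
    have "s (Suc r) n = of_int (jacobi_weight (Suc r) (Suc n) + (case n of 0 \<Rightarrow> - jacobi_weight (Suc r) 0 | Suc m \<Rightarrow> jacobi_weight (Suc r) m))" for n
      by (simp add: s_def split: nat.split)
    then have "s (Suc r) n = 2 * of_int (jacobi_weight (Suc r) n) - of_int (jacobi_weight r n)" for n
      unfolding jacobi_weight_second_difference by simp
    then have *: "(\<Sum>n\<le>N. jacobi_coeff N n * s (Suc r) n)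
        = 2 * (U_upto (Suc r) N * euler N ^ 2) - U_upto r N * euler N ^ 2"
      unfolding Suc.IH by (simp add: sum_distrib_left sum_subtractf right_diff_distrib mult.left_commute)
    \<comment> \<open>the new factor of the squared Euler product cancels the denominator of the new term\<close>
    have "(1 - Q) ^ 2 * inv_sq (Suc N) = 1"
      using inv_sq_unique[of "Suc N" "inv_sq (Suc N)"] by (simp add: Q_def)
    then show ?thesis
      unfolding step Suc * eu U_upto.simps Q_def[symmetric] by algebra
  qed
qed

text \<open>
  By the product formula the \<open>q\<close>-binomial coefficient tends to the inverse of the Euler product, with
  an error of order above \<open>N - n\<close>; the factor \<open>X ^ triangle n\<close> of order at least \<open>n\<close>
  makes the error uniform in \<open>n\<close>.
\<close>

lemma phi_jacobi_coeff_dvd: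
  assumes "n \<le> N"
  shows "fps_X ^ Suc N dvd phi * jacobi_coeff N n - (-1) ^ n * fps_X ^ triangle n"
proof -
  let ?G = "qbin (2 * N + 1) (N - n)"
  have X: "fps_X ^ Suc (N - n) dvd phi - euler m" if "N - n \<le> m" for m
    using phi_diff_dvd[of m] that by (meson Suc_le_mono dvd_trans le_imp_power_dvd)
  have e: "?G * euler (N - n) * euler (N + n + 1) = euler (2 * N + 1)"
    using qbin_euler[of "N - n" "N + n + 1"] assms by (simp add: mult_2)
  have "?G * phi * phi - phi = ?G * phi * (phi - euler (N + n + 1))
      + ?G * euler (N + n + 1) * (phi - euler (N - n)) - (phi - euler (2 * N + 1))"
    unfolding e[symmetric] by (simp add: algebra_simps)
  also have "fps_X ^ Suc (N - n) dvd \<dots>"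
    using assms by (intro dvd_diff dvd_add dvd_mult X) auto
  finally have *: "fps_X ^ Suc (N - n) dvd phi * (phi * ?G - 1)"
    by (simp add: algebra_simps)
  \<comment> \<open>the outer factor \<open>phi\<close> is a unit and can be removed\<close>
  have "fps_X ^ Suc (N - n) dvd phi * ?G - 1"
  proof -
    define \<psi> where "\<psi> = fps_right_inverse phi 1"
    have "phi * \<psi> = 1"
      unfolding \<psi>_def by (rule fps_right_inverse) simp
    then have "phi * ?G - 1 = \<psi> * (phi * (phi * ?G - 1))"
      by algebra
    with * show ?thesis by (metis dvd_mult)
  qed
  then have "fps_X ^ n * fps_X ^ Suc (N - n) dvd fps_X ^ triangle n * (phi * ?G - 1)"
    by (intro mult_dvd_mono le_imp_power_dvd le_triangle)
  moreover have "fps_X ^ n * fps_X ^ Suc (N - n) = (fps_X ^ Suc N :: int fps)"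
    using assms by (simp flip: power_add power_Suc)
  ultimately have "fps_X ^ Suc N dvd (-1) ^ n * (fps_X ^ triangle n * (phi * ?G - 1))"
    by (simp del: power_Suc)
  then show ?thesis
    using assms by (simp add: jacobi_coeff_def algebra_simps del: power_Suc)
qed

lemma U_upto_phi:
  "fps_X ^ Suc N dvd U_upto t N * phi ^ 3 - (\<Sum>n\<le>N. of_int ((-1) ^ n * jacobi_weight t n) * fps_X ^ triangle n)"
proof -
  have "U_upto t N * phi ^ 3 - phi * (\<Sum>n\<le>N. jacobi_coeff N n * of_int (jacobi_weight t n))
      = U_upto t N * phi * (phi + euler N) * (phi - euler N)"
    unfolding U_upto_euler[symmetric] by algebra
  then have 1: "fps_X ^ Suc N dvd U_upto t N * phi ^ 3 - phi * (\<Sum>n\<le>N. jacobi_coeff N n * of_int (jacobi_weight t n))"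
    using phi_diff_dvd[of N] by simp
  have "phi * (\<Sum>n\<le>N. jacobi_coeff N n * of_int (jacobi_weight t n)) - (\<Sum>n\<le>N. of_int ((-1) ^ n * jacobi_weight t n) * fps_X ^ triangle n)
      = (\<Sum>n\<le>N. of_int (jacobi_weight t n) * (phi * jacobi_coeff N n - (-1) ^ n * fps_X ^ triangle n))"
    by (simp add: sum_distrib_left sum_subtractf algebra_simps)
  also have "fps_X ^ Suc N dvd \<dots>"
    by (intro dvd_sum dvd_mult phi_jacobi_coeff_dvd) simp
  finally show ?thesis
    using dvd_add[OF 1] by fastforce
qed

definition bounded_tuples :: "nat \<Rightarrow> nat \<Rightarrow> nat list set" where
  "bounded_tuples t N = {ks \<in> increasing_tuples t. \<forall>k\<in>set ks. k \<le> N}"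

lemma finite_bounded_tuples: "finite (bounded_tuples t N)"
proof (rule finite_subset)
  show "bounded_tuples t N \<subseteq> {ks. set ks \<subseteq> {..N} \<and> length ks = t}"
    by (auto simp: bounded_tuples_def increasing_tuples_def)
qed (simp add: finite_lists_length_eq)

lemma bounded_tuples_Suc_Suc:
  "bounded_tuples (Suc t) (Suc N) =
    bounded_tuples (Suc t) N \<union> (\<lambda>ks. ks @ [Suc N]) ` bounded_tuples t N" (is "?L = ?R")
proof (intro equalityI subsetI)
  fix ks assume ks: "ks \<in> ?L"
  then obtain js k where jk: "ks = js @ [k]"
    by (cases ks rule: rev_cases) (auto simp: bounded_tuples_def increasing_tuples_def)
  show "ks \<in> ?R"
  proof (cases "k = Suc N")
    case True
    then have "js \<in> bounded_tuples t N"
      using ks by (auto simp: jk bounded_tuples_def increasing_tuples_def sorted_wrt_append)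
    then show ?thesis using jk True by blast
  next
    case False
    then have "ks \<in> bounded_tuples (Suc t) N"
      using ks by (fastforce simp: jk bounded_tuples_def increasing_tuples_def sorted_wrt_append)
    then show ?thesis by blast
  qed
qed (auto simp: bounded_tuples_def increasing_tuples_def sorted_wrt_append less_Suc_eq_le intro: le_SucI)

lemma U_upto_eq_sum: "U_upto t N = (\<Sum>ks\<in>bounded_tuples t N. U_term ks)"
proof (induction t N rule: U_upto.induct)
  case (1 N)
  have "bounded_tuples 0 N = {[]}"
    by (auto simp: bounded_tuples_def increasing_tuples_def)
  then show ?case by (simp add: U_term_def)
next
  case (2 t)
  have "bounded_tuples (Suc t) 0 = {}"
  proof -
    have False if ks: "ks \<in> bounded_tuples (Suc t) 0" for ks
      using that by (cases ks) (auto simp: bounded_tuples_def increasing_tuples_def)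
    then show ?thesis by blast
  qed
  then show ?case by simp
next
  case (3 t N)
  have disj: "bounded_tuples (Suc t) N \<inter> (\<lambda>ks. ks @ [Suc N]) ` bounded_tuples t N = {}"
    by (auto simp: bounded_tuples_def)
  have "U_term (ks @ [Suc N]) = fps_X ^ Suc N * inv_sq (Suc N) * U_term ks" for ks
    by (simp add: U_term_def power_add)
  then have "(\<Sum>ks\<in>(\<lambda>ks. ks @ [Suc N]) ` bounded_tuples t N. U_term ks)
      = fps_X ^ Suc N * inv_sq (Suc N) * (\<Sum>ks\<in>bounded_tuples t N. U_term ks)"
    by (simp add: sum.reindex inj_on_def sum_distrib_left del: power_Suc)
  then show ?case
    unfolding bounded_tuples_Suc_Suc U_upto.simps 3
    by (simp add: sum.union_disjoint disj finite_bounded_tuples del: power_Suc)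
qed

lemma U_diff_U_upto_dvd: "fps_X ^ Suc N dvd U t - U_upto t N"
  unfolding X_power_dvd_iff
proof (intro allI impI)
  fix n assume n: "n < Suc N"
  have "fps_nth (U_upto t N) n = (\<Sum>ks\<in>bounded_tuples t N. fps_nth (U_term ks) n)"
    by (simp add: U_upto_eq_sum fps_sum_nth)
  also have "\<dots> = (\<Sum>ks | ks \<in> increasing_tuples t \<and> sum_list ks \<le> n. fps_nth (U_term ks) n)"
  proof (rule sum.mono_neutral_right[OF finite_bounded_tuples])
    show "{ks \<in> increasing_tuples t. sum_list ks \<le> n} \<subseteq> bounded_tuples t N"
      using n member_le_sum_list by (fastforce simp: bounded_tuples_def)
    show "\<forall>ks\<in>bounded_tuples t N - {ks \<in> increasing_tuples t. sum_list ks \<le> n}. fps_nth (U_term ks) n = 0"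
      by (auto simp: bounded_tuples_def intro!: U_term_nth_eq_0)
  qed
  finally show "fps_nth (U t - U_upto t N) n = 0"
    using MO_eq_finite_sum[of t n] by (simp add: MO_def)
qed

text \<open>
  The limit \<open>N \<rightarrow> \<infinity>\<close> of \<open>U_upto_phi\<close>.
\<close>

lemma U_phi_nth:
  "fps_nth (U t * phi ^ 3) m = (\<Sum>n\<le>m. if m = triangle n then (-1) ^ n * jacobi_weight t n else 0)"
proof -
  let ?S = "\<Sum>n\<le>m. of_int ((-1) ^ n * jacobi_weight t n) * fps_X ^ triangle n :: int fps"
  have "fps_X ^ Suc m dvd (U t - U_upto t m) * phi ^ 3 + (U_upto t m * phi ^ 3 - ?S)"
    by (intro dvd_add dvd_mult2 U_diff_U_upto_dvd U_upto_phi)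
  then have "fps_X ^ Suc m dvd U t * phi ^ 3 - ?S"
    by (simp add: algebra_simps)
  then have "fps_nth (U t * phi ^ 3) m = fps_nth ?S m"
    unfolding X_power_dvd_iff by simp
  also have "\<dots> = (\<Sum>n\<le>m. if m = triangle n then (-1) ^ n * jacobi_weight t n else 0)"
    unfolding fps_sum_nth
    by (intro sum.cong refl) (simp add: fps_of_int[symmetric] del: of_int_mult of_int_power)
  finally show ?thesis .
qed

section \<open>Polynomial identities between the parts of the Euler product\<close>

text \<open>
  Give an exponent \<open>k\<close> of \<open>E\<close> the weight \<open>24 k + 1\<close> modulo 11. The parts
  \<open>a, b, c, d, e, z\<close> of \<open>E\<close> (classes 0, 1, 4, 2, 7, 5) then have the weights
  1, 3, 9, 5, 4, 0, so that multiplication of weights by 3 permutes \<open>a, b, c, d, e\<close> cyclically and fixes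
  \<open>z\<close>. Every homogeneous component of a power of \<open>a + b + c + d + e + z\<close> of nonzero weight is
  therefore a cyclic shift of the one of weight 1 or of the one of a fixed nonresidue weight.

  The component of weight 1 of the cube is \<open>cubic_component\<close>, that of weight 7 is three times
  \<open>cubic_relation\<close>. In the fourth power, \<open>quartic_component\<close> and
  \<open>quartic_component'\<close> are the components of weights 1 and 10, after omission of the components of the
  cube of nonresidue weight or weight 0.
\<close>

definition cubic_component :: "'a::idom \<Rightarrow> 'a \<Rightarrow> 'a \<Rightarrow> 'a \<Rightarrow> 'a \<Rightarrow> 'a \<Rightarrow> 'a" where
  "cubic_component a b c d e z = 3*a*z^2 + 6*b*c*z + 6*b*d*e + 3*c^2*d + e^3"

definition cubic_relation :: "'a::idom \<Rightarrow> 'a \<Rightarrow> 'a \<Rightarrow> 'a \<Rightarrow> 'a \<Rightarrow> 'a \<Rightarrow> 'a" where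
  "cubic_relation a b c d e z = a^2*d + a*b^2 + 2*b*e*z + c^2*z + 2*c*d*e"

definition quartic_component :: "'a::idom \<Rightarrow> 'a \<Rightarrow> 'a \<Rightarrow> 'a \<Rightarrow> 'a \<Rightarrow> 'a \<Rightarrow> 'a" where
  "quartic_component a b c d e z =
     z * cubic_component a b c d e z + b * cubic_component c d e a b z + c * cubic_component b c d e a z"

definition quartic_component' :: "'a::idom \<Rightarrow> 'a \<Rightarrow> 'a \<Rightarrow> 'a \<Rightarrow> 'a \<Rightarrow> 'a \<Rightarrow> 'a" where
  "quartic_component' a b c d e z =
     a * cubic_component c d e a b z + c * cubic_component a b c d e z + d * cubic_component d e a b c z"

definition cyclic_sum :: "('a \<Rightarrow> 'a \<Rightarrow> 'a \<Rightarrow> 'a \<Rightarrow> 'a \<Rightarrow> 'a \<Rightarrow> 'a) \<Rightarrow> 'a \<Rightarrow> 'a \<Rightarrow> 'a \<Rightarrow> 'a \<Rightarrow> 'a \<Rightarrow> 'a \<Rightarrow> 'a::idom" where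
  "cyclic_sum f a b c d e z = f a b c d e z + f b c d e a z + f c d e a b z + f d e a b c z + f e a b c d z"

text \<open>
  The component of weight 0 of the eighth power consists of the products of components of opposite weights of the
  fourth power; by the cyclic symmetry its essential part is the left-hand side. The right-hand side shows that it
  lies in the ideal generated by 11 and the cyclic shifts of \<open>cubic_relation\<close>. The cofactor
  \<open>Q\<close> is homogeneous of degree 5 and weight 4; its coefficients solve a system of linear equations over the field
  with 11 elements. The polynomial \<open>R\<close> is the remaining difference divided by 11.
\<close>

lemma octic_certificate:
  fixes a b c d e z :: "'a::idom"
  defines "Q \<equiv> \<lambda>a b c d e z. 4*a^4*z + 12*a^3*b*c + 16*a^2*b*d^2 + 6*a*b^3*d + 14*a*b^2*e^2
      + 9*a*b*z^3 - 5*a*c^4 + 7*a*c*d*z^2 + b^5 + 6*b^2*c*z^2 + 6*b*c^2*d*z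
      + 10*b*e^3*z + 7*c^3*d^2 - 15*c^2*e^2*z + 9*e*z^4"
    and "R \<equiv> \<lambda>a b c d e z. 3*a^5*b^2*z + 4*a^5*b*c*d + a^5*c*e^2 + 11*a^4*b*e*z^2 + 6*a^4*c*d*e*z
      + 4*a^3*b^3*d^2 + 24*a^3*b^2*c*e*z + 9*a^3*b^2*d*e^2 + 18*a^3*b*c^2*d*e
      + 10*a^3*b*d*z^3 + 8*a^3*c*d^2*z^2 + 9*a^3*e^2*z^3 + 60*a^2*b^2*c*d*z^2
      + 44*a^2*b^2*d^2*e*z + 9*a^2*d*e*z^4 + 20*a*b*c*d*e*z^3"
  shows "cyclic_sum (\<lambda>a b c d e z. quartic_component a b c d e z * quartic_component' a b c d e z) a b c d e z =
    cyclic_sum (\<lambda>a b c d e z. Q a b c d e z * cubic_relation a b c d e z + 11 * R a b c d e z) a b c d e z"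
  unfolding cyclic_sum_def quartic_component_def quartic_component'_def cubic_component_def
    cubic_relation_def Q_def R_def
  by algebra

lemma eleven_dvd_octic:
  fixes a b c d e z :: "'a::idom"
  assumes "cubic_relation a b c d e z = 0" "cubic_relation b c d e a z = 0"
    "cubic_relation c d e a b z = 0" "cubic_relation d e a b c z = 0" "cubic_relation e a b c d z = 0"
  shows "11 dvd cyclic_sum (\<lambda>a b c d e z. quartic_component a b c d e z * quartic_component' a b c d e z) a b c d e z"
  unfolding octic_certificate cyclic_sum_def assms mult_zero_right add_0 by (intro dvd_add dvd_triv_left)

section \<open>Exponents in a residue class modulo 11\<close>

definition class_part :: "nat \<Rightarrow> int fps \<Rightarrow> int fps" where
  "class_part r f = Abs_fps (\<lambda>n. if n mod 11 = r then fps_nth f n else 0)"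

lemma class_part_nth: "fps_nth (class_part r f) n = (if n mod 11 = r then fps_nth f n else 0)"
  by (simp add: class_part_def)

lemma class_part_mult:
  assumes "r < 11"
  shows "class_part r (f * g) = (\<Sum>j<11. class_part j f * class_part ((r + (11 - j)) mod 11) g)"
proof (rule fps_ext)
  fix n
  have *: "(\<Sum>j<11. fps_nth (class_part j f) i * fps_nth (class_part ((r + (11 - j)) mod 11) g) (n - i))
      = (if n mod 11 = r then fps_nth f i * fps_nth g (n - i) else 0)" if "i \<le> n" for i
  proof -
    have mod_if_less_22: "y mod 11 = (if y < 11 then y else y - 11)" if "y < 22" for y :: nat
      using that by (simp add: le_mod_geq)
    have "n mod 11 = ((n - i) mod 11 + i mod 11) mod 11"
      using that by (simp add: mod_add_eq)
    moreover have "(x + s) mod 11 = r \<longleftrightarrow> x = (r + (11 - s)) mod 11" if "x < 11" "s < 11" for x s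
      using that assms by (auto simp: mod_if_less_22 split: if_splits)
    ultimately have iff: "(n - i) mod 11 = (r + (11 - i mod 11)) mod 11 \<longleftrightarrow> n mod 11 = r"
      by simp
    have "(\<Sum>j<11. fps_nth (class_part j f) i * fps_nth (class_part ((r + (11 - j)) mod 11) g) (n - i))
      = (\<Sum>j<11. if j = i mod 11 then fps_nth f i * fps_nth (class_part ((r + (11 - i mod 11)) mod 11) g) (n - i) else 0)"
      by (intro sum.cong refl) (auto simp: class_part_nth)
    also have "\<dots> = fps_nth f i * fps_nth (class_part ((r + (11 - i mod 11)) mod 11) g) (n - i)"
      by simp
    also have "\<dots> = (if n mod 11 = r then fps_nth f i * fps_nth g (n - i) else 0)"
      unfolding class_part_nth iff by simp
    finally show ?thesis .
  qed
  have "fps_nth (\<Sum>j<11. class_part j f * class_part ((r + (11 - j)) mod 11) g) n =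
      (\<Sum>i=0..n. \<Sum>j<11. fps_nth (class_part j f) i * fps_nth (class_part ((r + (11 - j)) mod 11) g) (n - i))"
    unfolding fps_sum_nth fps_mult_nth by (rule sum.swap)
  also have "\<dots> = (\<Sum>i=0..n. if n mod 11 = r then fps_nth f i * fps_nth g (n - i) else 0)"
    by (intro sum.cong refl *) simp
  also have "\<dots> = fps_nth (class_part r (f * g)) n"
    by (simp add: class_part_nth fps_mult_nth)
  finally show "fps_nth (class_part r (f * g)) n = fps_nth (\<Sum>j<11. class_part j f * class_part ((r + (11 - j)) mod 11) g) n" ..
qed

lemma sum_lessThan_11: "(\<Sum>j<11. h j) =
   h 0 + h 1 + h 2 + h 3 + h 4 + h 5 + h 6 + h 7 + h 8 + h 9 + (h (10::nat) :: 'a::comm_monoid_add)"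
  by (simp add: eval_nat_numeral ac_simps)

text \<open>
  Jacobi's identity for the cube of the Euler product is the case \<open>t = 0\<close> of
  \<open>U_phi_nth\<close>.
\<close>

lemma phi_cubed_nth: "fps_nth (phi ^ 3) m = (\<Sum>n\<le>m. if m = triangle n then (-1) ^ n * (2 * int n + 1) else 0)"
proof -
  have "fps_X ^ Suc m dvd U 0 - 1"
    using U_diff_U_upto_dvd[of m 0] by simp
  then have "fps_X ^ Suc m dvd (U 0 - 1) * phi ^ 3"
    by (rule dvd_mult2)
  then have "fps_nth (phi ^ 3) m = fps_nth (U 0 * phi ^ 3) m"
    unfolding X_power_dvd_iff by (simp add: algebra_simps)
  then show ?thesis
    by (simp only: U_phi_nth jacobi_weight_0)
qed

lemma triangle_mod_11:
  "triangle n mod 11 = (6 * (n mod 11) * (n mod 11 + 1)) mod 11"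
proof -
  have "triangle n + 11 * triangle n = 6 * n * (n + 1)"
    using two_triangle[of n] by simp
  then have "triangle n mod 11 = (6 * n * (n + 1)) mod 11"
    by (metis mod_mult_self2)
  also have "\<dots> = (6 * (n mod 11) * (n mod 11 + 1)) mod 11"
    by (intro mod_mult_cong mod_add_cong refl) simp_all
  finally show ?thesis .
qed

lemma mod_11_cases:
  fixes n :: nat
  obtains "n mod 11 = 0" | "n mod 11 = 1" | "n mod 11 = 2" | "n mod 11 = 3" | "n mod 11 = 4" | "n mod 11 = 5"
    | "n mod 11 = 6" | "n mod 11 = 7" | "n mod 11 = 8" | "n mod 11 = 9" | "n mod 11 = 10"
proof -
  have "n mod 11 = 0 \<or> n mod 11 = 1 \<or> n mod 11 = 2 \<or> n mod 11 = 3 \<or> n mod 11 = 4 \<or> n mod 11 = 5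
    \<or> n mod 11 = 6 \<or> n mod 11 = 7 \<or> n mod 11 = 8 \<or> n mod 11 = 9 \<or> n mod 11 = 10"
    by presburger
  then show ?thesis
    by (elim disjE) (fact that)+
qed

lemma phi_cubed_nth_eq_0:
  assumes "m mod 11 \<notin> {0, 1, 3, 4, 6, 10}"
  shows "fps_nth (phi ^ 3) m = 0"
proof -
  have "triangle n mod 11 \<in> {0, 1, 3, 4, 6, 10}" for n
    by (cases n rule: mod_11_cases) (simp_all add: triangle_mod_11)
  then have "m \<noteq> triangle n" for n
    using assms by metis
  then show ?thesis by (simp add: phi_cubed_nth)
qed

text \<open>
  A triangular number \<open>n (n + 1) / 2\<close> is congruent to 4 only if \<open>n\<close> is congruent to 5,
  and then 11 divides \<open>2 n + 1\<close>.
\<close>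

lemma eleven_dvd_phi_cubed_nth:
  assumes "m mod 11 = 4"
  shows "11 dvd fps_nth (phi ^ 3) m"
  unfolding phi_cubed_nth
proof (intro dvd_sum)
  fix n
  have "11 dvd 2 * int n + 1" if "triangle n mod 11 = 4"
  proof -
    have "n mod 11 = 5"
      using that by (cases n rule: mod_11_cases) (simp_all add: triangle_mod_11)
    then show ?thesis by presburger
  qed
  then show "11 dvd (if m = triangle n then (-1) ^ n * (2 * int n + 1) else 0)"
    using assms by auto
qed

lemma fact_times_choose: "int (fact k * (n choose k)) = (\<Prod>i<k. int n - int i)"
proof (induction k)
  case (Suc k)
  have *: "int (Suc k) * int (n choose Suc k) = (int n - int k) * int (n choose k)"
  proof (cases "k \<le> n")
    case True
    then have "int n - int k = int (n - k)" by simp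
    then show ?thesis
      by (metis binomial_absorb_comp binomial_absorption of_nat_mult mult.commute)
  qed (simp add: binomial_eq_0)
  have "int (fact (Suc k) * (n choose Suc k)) = int (fact k) * (int (Suc k) * int (n choose Suc k))"
    by (simp only: fact_Suc of_nat_mult of_nat_id mult_ac)
  also have "\<dots> = (int n - int k) * (int (fact k * (n choose k)))"
    unfolding * by (simp only: of_nat_mult of_nat_fact mult_ac)
  also have "\<dots> = (\<Prod>i<Suc k. int n - int i)"
    by (simp only: Suc.IH prod.lessThan_Suc mult.commute)
  finally show ?case .
qed simp

text \<open>
  The factors on the right vanish modulo 11 for every class of \<open>n\<close> except 4 and 6.
\<close>

lemma fact_times_jacobi_weight_4:
  "fact 9 * jacobi_weight 4 n = (2 * int n + 1) * (\<Prod>i<8. int (n + 4) - int i)"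
proof -
  define P where "P = (\<Prod>i<8. int (n + 4) - int i)"
  have 8: "fact 8 * int ((n + 4) choose 8) = P"
    using fact_times_choose[of 8 "n + 4"] by (simp add: P_def)
  have 9: "fact 9 * int ((n + 4) choose 9) = P * (int n - 4)"
  proof -
    have "fact 9 * int ((n + 4) choose 9) = (\<Prod>i<Suc 8. int (n + 4) - int i)"
      using fact_times_choose[of 9 "n + 4"] by simp
    then show ?thesis
      using prod.lessThan_Suc[of "\<lambda>i. int (n + 4) - int i" 8] by (simp add: P_def)
  qed
  have "fact 9 = (9 * fact 8 :: int)"
    by (simp add: fact_numeral)
  then have "fact 9 * jacobi_weight 4 n = 9 * (fact 8 * int ((n + 4) choose 8)) + 2 * (fact 9 * int ((n + 4) choose 9))"
    by (simp add: jacobi_weight_def algebra_simps)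
  also have "\<dots> = (2 * int n + 1) * P"
    unfolding 8 9 by (simp add: algebra_simps)
  finally show ?thesis by (simp add: P_def)
qed

lemma eleven_dvd_jacobi_weight_4:
  assumes "triangle n mod 11 \<noteq> 10"
  shows "11 dvd jacobi_weight 4 n"
proof -
  have "11 dvd (2 * int n + 1) * (\<Prod>i<8. int (n + 4) - int i)"
  proof (cases "n mod 11 = 5")
    case True
    then have "11 dvd 2 * int n + 1" by presburger
    then show ?thesis by simp
  next
    case False
    define i where "i = (n + 4) mod 11"
    have "i = (n mod 11 + 4) mod 11"
      by (simp add: i_def mod_add_left_eq)
    then have i: "i < 8"
      using assms False by (cases n rule: mod_11_cases) (simp_all add: triangle_mod_11)
    have "11 dvd int (n + 4) - int i"
      using dvd_minus_mod[of 11 "int (n + 4)"] by (simp add: i_def zmod_int)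
    also have "\<dots> dvd (\<Prod>i<8. int (n + 4) - int i)"
      using i by (intro dvd_prodI) auto
    finally show ?thesis by simp
  qed
  then have "11 dvd fact 9 * jacobi_weight 4 n"
    by (simp only: fact_times_jacobi_weight_4)
  moreover have "prime (11::int)" "\<not> 11 dvd (fact 9 :: int)"
    by (simp_all add: fact_numeral)
  ultimately show ?thesis
    using prime_dvd_multD by blast
qed

lemma eleven_dvd_U_4_phi_cubed_nth:
  assumes "m mod 11 \<noteq> 10"
  shows "11 dvd fps_nth (U 4 * phi ^ 3) m"
  unfolding U_phi_nth
  by (intro dvd_sum) (use assms eleven_dvd_jacobi_weight_4 in auto)

lemma class_part_phi_eq_0:
  "class_part 3 phi = 0" "class_part 6 phi = 0" "class_part 8 phi = 0" "class_part 9 phi = 0" "class_part 10 phi = 0"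
  by (rule fps_ext, simp add: class_part_nth phi_nth_eq_0)+

lemma class_part_phi_cubed_eq_0:
  "class_part 2 (phi ^ 3) = 0" "class_part 5 (phi ^ 3) = 0" "class_part 7 (phi ^ 3) = 0" "class_part 8 (phi ^ 3) = 0" "class_part 9 (phi ^ 3) = 0"
  by (rule fps_ext, simp add: class_part_nth phi_cubed_nth_eq_0)+

text \<open>
  The components of \<open>phi ^ 8\<close> are built up through the powers 2, 3 and 4 from the parts of \<open>phi\<close>.
  Class \<open>k\<close> of the \<open>j\<close>-th power has weight \<open>24 k + j\<close>, so class 7 of the eighth
  power has weight 0, and Jacobi's identity leaves in the cube only classes of residue weight, up to the multiple
  \<open>11 * s\<close> in weight 0.
\<close>

lemma eleven_dvd_class_part_7_phi_power_8: "11 dvd class_part 7 (phi ^ 8)"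
proof -
  define a b c d e z where abc: "a = class_part 0 phi" "b = class_part 1 phi" "c = class_part 4 phi" "d = class_part 2 phi"
    "e = class_part 7 phi" "z = class_part 5 phi"
  have "11 dvd class_part 4 (phi ^ 3)"
    by (simp add: numeral_dvd_fps_iff class_part_nth eleven_dvd_phi_cubed_nth)
  then obtain s where s: "class_part 4 (phi ^ 3) = 11 * s"
    by (rule dvdE)
  note expand = class_part_mult sum_lessThan_11 class_part_phi_eq_0 abc[symmetric, unfolded One_nat_def]
  have square:
    "class_part 0 (phi ^ 2) = a^2 + 2*c*e" "class_part 1 (phi ^ 2) = 2*a*b + 2*e*z" "class_part 2 (phi ^ 2) = 2*a*d + b^2"
    "class_part 3 (phi ^ 2) = 2*b*d + e^2" "class_part 4 (phi ^ 2) = 2*a*c + d^2" "class_part 5 (phi ^ 2) = 2*a*z + 2*b*c"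
    "class_part 6 (phi ^ 2) = 2*b*z + 2*c*d" "class_part 7 (phi ^ 2) = 2*a*e + 2*d*z" "class_part 8 (phi ^ 2) = 2*b*e + c^2"
    "class_part 9 (phi ^ 2) = 2*c*z + 2*d*e" "class_part 10 (phi ^ 2) = z^2"
    unfolding power2_eq_square[of phi]
    by (simp_all add: expand power2_eq_square algebra_simps)
  note square = square[unfolded One_nat_def]
  have phi_3: "phi ^ 3 = phi * phi ^ 2"
    by (simp add: power2_eq_square power3_eq_cube)
  have cube:
    "class_part 10 (phi ^ 3) = cubic_component a b c d e z" "class_part 0 (phi ^ 3) = cubic_component b c d e a z"
    "class_part 3 (phi ^ 3) = cubic_component c d e a b z" "class_part 1 (phi ^ 3) = cubic_component d e a b c z"
    "class_part 6 (phi ^ 3) = cubic_component e a b c d z"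
    unfolding phi_3
    by (simp_all add: expand square cubic_component_def power2_eq_square power3_eq_cube algebra_simps)
  note cube = cube[unfolded One_nat_def]
  have relation:
    "class_part 2 (phi ^ 3) = 3 * cubic_relation a b c d e z" "class_part 9 (phi ^ 3) = 3 * cubic_relation b c d e a z"
    "class_part 8 (phi ^ 3) = 3 * cubic_relation c d e a b z" "class_part 5 (phi ^ 3) = 3 * cubic_relation d e a b c z"
    "class_part 7 (phi ^ 3) = 3 * cubic_relation e a b c d z"
    unfolding phi_3
    by (simp_all add: expand square cubic_relation_def power2_eq_square algebra_simps)
  have phi_4: "phi ^ 4 = phi * phi ^ 3"
    by (simp add: eval_nat_numeral)
  have quartic:
    "class_part 4 (phi ^ 4) = quartic_component a b c d e z + 11 * s * a"
    "class_part 5 (phi ^ 4) = quartic_component b c d e a z + 11 * s * b"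
    "class_part 8 (phi ^ 4) = quartic_component c d e a b z + 11 * s * c"
    "class_part 6 (phi ^ 4) = quartic_component d e a b c z + 11 * s * d"
    "class_part 0 (phi ^ 4) = quartic_component e a b c d z + 11 * s * e"
    "class_part 9 (phi ^ 4) = 11 * s * z"
    "class_part 3 (phi ^ 4) = quartic_component' a b c d e z"
    "class_part 2 (phi ^ 4) = quartic_component' b c d e a z"
    "class_part 10 (phi ^ 4) = quartic_component' c d e a b z"
    "class_part 1 (phi ^ 4) = quartic_component' d e a b c z"
    "class_part 7 (phi ^ 4) = quartic_component' e a b c d z"
    unfolding phi_4
    by (simp_all add: expand cube class_part_phi_cubed_eq_0 s quartic_component_def quartic_component'_def
        algebra_simps)
  note quartic = quartic[unfolded One_nat_def]
  have phi_8: "phi ^ 8 = phi ^ 4 * phi ^ 4"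
    by (simp flip: power_add)
  have "class_part 7 (phi ^ 8) = (\<Sum>j<11. class_part j (phi ^ 4) * class_part ((7 + (11 - j)) mod 11) (phi ^ 4))"
    unfolding phi_8 by (rule class_part_mult) simp
  also have "\<dots> =
      2 * cyclic_sum (\<lambda>a b c d e z. quartic_component a b c d e z * quartic_component' a b c d e z) a b c d e z
      + 11 * (2 * s * (a * quartic_component' a b c d e z + b * quartic_component' b c d e a z
        + c * quartic_component' c d e a b z + d * quartic_component' d e a b c z
        + e * quartic_component' e a b c d z) + 11 * (s * z)^2)"
    by (simp add: sum_lessThan_11 quartic cyclic_sum_def power2_eq_square algebra_simps)
  also have "11 dvd \<dots>"
  proof -
    have "11 dvd cyclic_sum (\<lambda>a b c d e z. quartic_component a b c d e z * quartic_component' a b c d e z) a b c d e z"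
      by (rule eleven_dvd_octic) (use relation class_part_phi_cubed_eq_0 in auto)
    then show ?thesis
      by (simp only: dvd_add dvd_mult dvd_triv_left)
  qed
  finally show ?thesis .
qed

section \<open>The congruence\<close>

text \<open>
  The derivative of a \<open>p\<close>-th power is divisible by \<open>p\<close>, and its coefficient at
  \<open>m - 1\<close> is \<open>m\<close> times the coefficient of the power at \<open>m\<close>.
\<close>

lemma prime_dvd_power_prime_nth:
  fixes f :: "int fps"
  assumes "prime p" "\<not> p dvd m"
  shows "int p dvd fps_nth (f ^ p) m"
proof -
  obtain k where m: "m = Suc k"
    using assms by (cases m) auto
  have "fps_deriv (f ^ p) = of_nat p * (fps_deriv f * f ^ (p - 1))"
    by (simp add: fps_deriv_power' mult.assoc)
  then have "int m * fps_nth (f ^ p) m = fps_nth (of_nat p * (fps_deriv f * f ^ (p - 1))) k"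
    by (metis fps_deriv_nth m Suc_eq_plus1)
  then have "int p dvd int m * fps_nth (f ^ p) m"
    by (simp add: fps_of_nat[symmetric])
  moreover have "prime (int p)" "\<not> int p dvd int m"
    using assms by simp_all
  ultimately show ?thesis
    using prime_dvd_multD by blast
qed

text \<open>
  In class 6 of \<open>U 4 * phi ^ 11 = (U 4 * phi ^ 3) * phi ^ 8\<close> every product of coefficients on the
  right is divisible by 11. On the left, modulo 11 only exponents divisible by 11 contribute from
  \<open>phi ^ 11\<close>, so the coefficient of \<open>U 4\<close> at \<open>m\<close> is congruent to a combination of
  earlier coefficients in the same class.
\<close>

lemma eleven_dvd_U_4_nth:
  assumes "m mod 11 = 6"
  shows "11 dvd fps_nth (U 4) m"
  using assms
proof (induction m rule: less_induct)
  case (less m)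
  have product: "11 dvd fps_nth (U 4 * phi ^ 3 * phi ^ 8) m"
    unfolding fps_mult_nth[of "U 4 * phi ^ 3"]
  proof (intro dvd_sum)
    fix i assume i: "i \<in> {0..m}"
    show "11 dvd fps_nth (U 4 * phi ^ 3) i * fps_nth (phi ^ 8) (m - i)"
    proof (cases "i mod 11 = 10")
      case True
      have "k mod 11 = 7" if "(i + k) mod 11 = 6" for k
        using that True mod_add_eq[of i 11 k]
        by (cases k rule: mod_11_cases) (simp_all)
      from this[of "m - i"] have "(m - i) mod 11 = 7"
        using less.prems i by simp
      then have "fps_nth (phi ^ 8) (m - i) = fps_nth (class_part 7 (phi ^ 8)) (m - i)"
        by (simp add: class_part_nth)
      also have "11 dvd \<dots>"
        using eleven_dvd_class_part_7_phi_power_8 by (simp add: numeral_dvd_fps_iff)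
      finally show ?thesis by simp
    qed (simp add: eleven_dvd_U_4_phi_cubed_nth)
  qed
  have "phi ^ 11 = phi ^ 3 * phi ^ 8"
    by (simp flip: power_add)
  then have "U 4 * phi ^ 3 * phi ^ 8 = phi ^ 11 * U 4"
    by (simp only: mult_ac)
  moreover have "fps_nth (phi ^ 11 * U 4) m
      = fps_nth (U 4) m + (\<Sum>i\<in>{1..m}. fps_nth (phi ^ 11) i * fps_nth (U 4) (m - i))"
    unfolding fps_mult_nth by (subst sum.atLeast_Suc_atMost) (simp_all add: fps_power_zeroth)
  ultimately have "11 dvd fps_nth (U 4) m + (\<Sum>i\<in>{1..m}. fps_nth (phi ^ 11) i * fps_nth (U 4) (m - i))"
    using product by (simp only:)
  moreover have "11 dvd (\<Sum>i\<in>{1..m}. fps_nth (phi ^ 11) i * fps_nth (U 4) (m - i))"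
  proof (intro dvd_sum)
    fix i assume i: "i \<in> {1..m}"
    show "11 dvd fps_nth (phi ^ 11) i * fps_nth (U 4) (m - i)"
    proof (cases "11 dvd i")
      case True
      have "k mod 11 = 6" if "(i + k) mod 11 = 6" for k
        using that True mod_add_eq[of i 11 k]
        by (cases k rule: mod_11_cases) (simp_all add: dvd_eq_mod_eq_0)
      from this[of "m - i"] have "(m - i) mod 11 = 6"
        using less.prems i by simp
      then show ?thesis
        using less.IH[of "m - i"] i by simp
    qed (use prime_dvd_power_prime_nth[of 11 i] in simp)
  qed
  ultimately show ?case
    by (simp add: dvd_add_left_iff)
qed

theorem theorem8p6:
  fixes n :: nat
  shows "11 dvd MO 4 (11 * n + 6)"
  unfolding MO_def by (rule eleven_dvd_U_4_nth) presburger

end
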